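(* For every integer $k\geq 4$ and every integer $n\ge k$, $r(B^{(k)},K^{(k)}_n) \leq (n!)^{k-1}$.
   Context: A $k$-half-graph $B^{(k)}$ is the $k$-uniform hypergraph on $2k-2$ vertices with vertex set $S\cup T$, $S\cap T=\emptyset$, $|S|=|T|=k-1$, whose edges are all $k$-subsets of $S\cup T$ containing $S$ (i.e. $S\cup\{v\}$ for $v\in T$), together with one $k$-subset containing $T$ (i.e. $T\cup\{u\}$ for one $u\in S$). $K^{(k)}_n$ is the complete $k$-uniform hypergraph on $n$ vertices. $r(B^{(k)},K^{(k)}_n)$ is the minimum $N$ such that every red-blue coloring of the $k$-subsets of an $N$-element set contains a red copy of $B^{(k)}$ or a blue copy of $K^{(k)}_n$. *)

theory Defs
  imports "HOL-Library.Ramsey"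
begin

text \<open>A hypergraph is a pair of a vertex set and an edge set; \<open>[A]\<^bsup>k\<^esup>\<close> is the library's
  notation for the set of \<open>k\<close>-element subsets of \<open>A\<close>.\<close>

type_synonym 'a hypergraph = "'a set \<times> 'a set set"

abbreviation verts :: "'a hypergraph \<Rightarrow> 'a set" where
  "verts H \<equiv> fst H"

abbreviation edges :: "'a hypergraph \<Rightarrow> 'a set set" where
  "edges H \<equiv> snd H"

definition uniform :: "nat \<Rightarrow> 'a hypergraph \<Rightarrow> bool" where
  "uniform k H \<longleftrightarrow> edges H \<subseteq> [verts H]\<^bsup>k\<^esup>"

definition complete_hypergraph :: "nat \<Rightarrow> nat \<Rightarrow> nat hypergraph" where
  "complete_hypergraph k n = ({..<n}, [{..<n}]\<^bsup>k\<^esup>)"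

text \<open>The representative with \<open>S = {0, \<dots>, k - 2}\<close>, \<open>T = {k - 1, \<dots>, 2k - 3}\<close>, and
  \<open>T \<union> {0}\<close> as the edge containing \<open>T\<close>; any other choice of \<open>S\<close>, \<open>T\<close> and of the vertex
  of \<open>S\<close> in this edge gives an isomorphic hypergraph.\<close>

definition half_graph :: "nat \<Rightarrow> nat hypergraph" where
  "half_graph k =
     (let S = {..<k - 1}; T = {k - 1..<2 * k - 2}
      in (S \<union> T, {e \<in> [S \<union> T]\<^bsup>k\<^esup>. S \<subseteq> e} \<union> {insert 0 T}))"

text \<open>A copy is a not necessarily induced subhypergraph.\<close>

definition contains_copy :: "'b hypergraph \<Rightarrow> 'a hypergraph \<Rightarrow> bool" where
  "contains_copy G H \<longleftrightarrow>
     (\<exists>f. inj_on f (verts H) \<and> f ` verts H \<subseteq> verts G \<and> (\<forall>e\<in>edges H. f ` e \<in> edges G))"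

text \<open>A red-blue colouring of the \<open>k\<close>-subsets of \<open>{..<N}\<close> is given by its set \<open>R\<close> of red
  \<open>k\<close>-subsets; the others are blue.\<close>

definition ramsey_arrow :: "nat \<Rightarrow> nat \<Rightarrow> 'a hypergraph \<Rightarrow> 'b hypergraph \<Rightarrow> bool" where
  "ramsey_arrow k N H G \<longleftrightarrow>
     (\<forall>R \<subseteq> [{..<N}]\<^bsup>k\<^esup>.
        contains_copy ({..<N}, R) H \<or> contains_copy ({..<N}, [{..<N}]\<^bsup>k\<^esup> - R) G)"

definition ramsey_number :: "nat \<Rightarrow> 'a hypergraph \<Rightarrow> 'b hypergraph \<Rightarrow> nat" where
  "ramsey_number k H G = (LEAST N. ramsey_arrow k N H G)"

lemma uniform_complete_hypergraph: "uniform k (complete_hypergraph k n)"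
  by (simp add: uniform_def complete_hypergraph_def)

lemma uniform_half_graph:
  assumes "k \<ge> 2"
  shows "uniform k (half_graph k)"
proof -
  have "card (insert 0 {k - 1..<2 * k - 2}) = k"
    using assms by (subst card_insert_disjoint) auto
  moreover have "insert 0 {k - 1..<2 * k - 2} \<subseteq> {..<k - 1} \<union> {k - 1..<2 * k - 2}"
    using assms by auto
  ultimately show ?thesis
    by (auto simp: uniform_def half_graph_def Let_def nsets_def)
qed

lemma contains_copy_clique:
  assumes unif: "uniform k H" and fin: "finite (verts H)"
    and X: "X \<in> [V]\<^bsup>card (verts H)\<^esup>" and clique: "[X]\<^bsup>k\<^esup> \<subseteq> E"
  shows "contains_copy (V, E) H"
proof -
  have "finite X" "card X = card (verts H)" "X \<subseteq> V"
    using X by (auto simp: nsets_def)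
  then obtain f where f: "bij_betw f (verts H) X"
    using fin by (metis finite_same_card_bij)
  have "f ` e \<in> E" if "e \<in> edges H" for e
  proof -
    have e: "e \<subseteq> verts H" "finite e" "card e = k"
      using that unif by (auto simp: uniform_def nsets_def)
    then have "f ` e \<in> [X]\<^bsup>k\<^esup>"
      using f by (auto simp: nsets_def bij_betw_def card_image inj_on_subset)
    then show ?thesis
      using clique by blast
  qed
  then show ?thesis
    using f \<open>X \<subseteq> V\<close> unfolding contains_copy_def bij_betw_def by auto
qed

text \<open>By Ramsey's theorem the \<open>LEAST\<close> in the definition of \<^const>\<open>ramsey_number\<close> ranges over
  a nonempty set.\<close>

lemma ramsey_arrow_ramsey_number:
  assumes "uniform k H" "finite (verts H)" "uniform k G" "finite (verts G)"
  shows "ramsey_arrow k (ramsey_number k H G) H G"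
proof -
  obtain N :: nat where N: "partn_lst {..<N} [card (verts H), card (verts G)] k"
    using ramsey_full by blast
  have "contains_copy ({..<N}, R) H \<or> contains_copy ({..<N}, [{..<N}]\<^bsup>k\<^esup> - R) G" for R
  proof -
    define c where "c = (\<lambda>e. if e \<in> R then 0 else (1::nat))"
    have "c \<in> [{..<N}]\<^bsup>k\<^esup> \<rightarrow> {..<2}"
      by (auto simp: c_def)
    then obtain i X where i: "i < 2"
      and X: "X \<in> [{..<N}]\<^bsup>([card (verts H), card (verts G)] ! i)\<^esup>"
      and c: "c ` [X]\<^bsup>k\<^esup> \<subseteq> {i}"
      using N unfolding partn_lst_def monochromatic_def by (force simp: numeral_2_eq_2)
    show ?thesis
    proof (cases "i = 0")
      case True
      then have "[X]\<^bsup>k\<^esup> \<subseteq> R"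
        using c by (auto simp: c_def split: if_splits)
      then show ?thesis
        using contains_copy_clique[OF assms(1,2)] X True by auto
    next
      case False
      then have i1: "i = 1"
        using i by simp
      have "[X]\<^bsup>k\<^esup> \<subseteq> [{..<N}]\<^bsup>k\<^esup>"
        using X by (intro nsets_mono) (simp add: nsets_def)
      moreover have "e \<notin> R" if "e \<in> [X]\<^bsup>k\<^esup>" for e
        using c that i1 by (auto simp: c_def split: if_splits)
      ultimately have "[X]\<^bsup>k\<^esup> \<subseteq> [{..<N}]\<^bsup>k\<^esup> - R"
        by blast
      then show ?thesis
        using contains_copy_clique[OF assms(3,4)] X i1 by auto
    qed
  qed
  then have "ramsey_arrow k N H G"
    unfolding ramsey_arrow_def by blast
  then show ?thesis
    unfolding ramsey_number_def by (rule LeastI)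
qed

end

theory Submission
  imports Defs "HOL-Combinatorics.Transposition"
begin

text \<open>Induction on \<open>n\<close>, with \<open>r = ((n - 1)!)\<^bsup>k-1\<^esup>\<close>. If some \<open>(k-1)\<close>-set \<open>S\<close> is completed to
  a red edge by at least \<open>r\<close> vertices, these contain a blue clique of size \<open>n - 1\<close>, and it stays
  blue after adding any \<open>u \<in> S\<close>, because a red edge through \<open>u\<close> would complete a half-graph.
  Otherwise a maximal blue clique of size \<open>m < n\<close> has all remaining vertices in the red
  neighbourhoods of its \<open>(k-1)\<close>-subsets, so that there are at most
  \<open>m + (m choose (k-1)) (r - 1) < n\<^bsup>k-1\<^esup> r\<close> vertices in total.\<close>

text \<open>Vertices of \<open>S\<close> are excluded because for \<open>v \<in> S\<close> the set
  \<open>insert v S\<close> is \<open>S\<close> itself; the exclusion also makes every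
  \<open>T\<close> inside the neighbourhood disjoint from \<open>S\<close>. \<open>R\<close> stays
  independent of \<open>V\<close>, so one colouring serves for all vertex subsets.\<close>

definition red_nbhd :: "'a set set \<Rightarrow> 'a set \<Rightarrow> 'a set \<Rightarrow> 'a set" where
  "red_nbhd R V S = {v \<in> V - S. insert v S \<in> R}"

lemma red_nbhd_subset: "red_nbhd R V S \<subseteq> V"
  by (auto simp: red_nbhd_def)

text \<open>An edge of the half-graph containing its first side has just one further vertex, so its
  image is \<open>S\<close> plus a vertex of \<open>T\<close>, which is red by the choice of
  \<open>T\<close>. The one remaining edge goes to \<open>insert u T\<close>.\<close>

lemma contains_copy_half_graph:
  assumes S: "S \<in> [V]\<^bsup>(k-1)\<^esup>" and u: "u \<in> S"
    and T: "T \<in> [red_nbhd R V S]\<^bsup>(k-1)\<^esup>" and uT: "insert u T \<in> R"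
  shows "contains_copy (V, R) (half_graph k)"
proof -
  let ?A = "{..<k - 1}" and ?B = "{k - 1..<2 * k - 2}"
  have finS: "finite S" "card S = k - 1" "S \<subseteq> V" using S by (auto simp: nsets_def)
  have finT: "finite T" "card T = k - 1" "T \<subseteq> red_nbhd R V S" using T by (auto simp: nsets_def)
  have k: "k - 1 > 0" using finS u by (metis card_gt_0_iff empty_iff)
  have disj: "S \<inter> T = {}" using finT by (auto simp: red_nbhd_def)
  obtain g0 where g0: "bij_betw g0 ?A S"
    using finS by (metis card_lessThan finite_lessThan finite_same_card_bij)
  then obtain a where a: "a \<in> ?A" "g0 a = u" using u by (auto simp: bij_betw_def)
  \<comment> \<open>\<open>half_graph\<close> singles out the vertex 0 in the edge containing the
    second side, so the bijection is adjusted to send 0 to \<open>u\<close>.\<close>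
  define g where "g = g0 \<circ> transpose 0 a"
  have "bij_betw (transpose 0 a) ?A ?A" using a(1) k by simp
  then have g: "bij_betw g ?A S" "g 0 = u"
    using g0 a(2) by (simp_all add: g_def bij_betw_trans)
  have "card ?B = card T" using finT by auto
  then obtain h where h: "bij_betw h ?B T"
    using finT by (metis finite_atLeastLessThan finite_same_card_bij)
  define f where "f x = (if x < k - 1 then g x else h x)" for x
  have fA: "bij_betw f ?A S" using g(1) by (subst bij_betw_cong[of _ f g]) (auto simp: f_def)
  have fB: "bij_betw f ?B T" using h by (subst bij_betw_cong[of _ f h]) (auto simp: f_def)
  have f: "bij_betw f (?A \<union> ?B) (S \<union> T)" using bij_betw_combine[OF fA fB disj] .
  have "f ` e \<in> R" if e: "e \<in> [?A \<union> ?B]\<^bsup>k\<^esup>" "?A \<subseteq> e" for e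
  proof -
    have "finite e" "card e = k" "e \<subseteq> ?A \<union> ?B" using e by (auto simp: nsets_def)
    moreover have "card (e - ?A) = 1"
      using e(2) \<open>card e = k\<close> k by (subst card_Diff_subset) auto
    then obtain v where "e - ?A = {v}" by (auto simp: card_1_singleton_iff)
    ultimately have v: "e = insert v ?A" "v \<in> ?B" using e(2) by auto
    have "f v \<in> T" using v(2) fB by (auto simp: bij_betw_def)
    moreover have "f ` e = insert (f v) S" using v(1) fA by (auto simp: bij_betw_def)
    ultimately show ?thesis using finT(3) by (auto simp: red_nbhd_def)
  qed
  moreover have "f 0 = u" using g(2) k by (simp add: f_def)
  then have "f ` insert 0 ?B = insert u T" using fB by (simp add: bij_betw_def)
  moreover have "S \<union> T \<subseteq> V" using finS finT(3) red_nbhd_subset by fastforce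
  ultimately show ?thesis
    unfolding contains_copy_def half_graph_def Let_def
    using f uT by (intro exI[of _ f]) (auto simp: bij_betw_def)
qed

lemma large_red_nbhd_extends_clique:
  assumes k: "k \<ge> 2" and no: "\<not> contains_copy (V, R) (half_graph k)"
    and S: "S \<in> [V]\<^bsup>(k-1)\<^esup>"
    and I: "I \<in> [red_nbhd R V S]\<^bsup>n\<^esup>" and blue: "[I]\<^bsup>k\<^esup> \<inter> R = {}"
  shows "\<exists>J \<in> [V]\<^bsup>Suc n\<^esup>. [J]\<^bsup>k\<^esup> \<inter> R = {}"
proof -
  have "card S = k - 1" "S \<subseteq> V" using S by (auto simp: nsets_def)
  then obtain u where u: "u \<in> S" using k by fastforce
  have Iprops: "finite I" "card I = n" "I \<subseteq> red_nbhd R V S" using I by (auto simp: nsets_def)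
  then have uI: "u \<notin> I" using u by (auto simp: red_nbhd_def)
  have "insert u I \<in> [V]\<^bsup>Suc n\<^esup>"
    using Iprops uI u \<open>S \<subseteq> V\<close> red_nbhd_subset[of R V S] by (auto simp: nsets_def)
  moreover have "e \<notin> R" if e: "e \<in> [insert u I]\<^bsup>k\<^esup>" for e
  proof (cases "u \<in> e")
    case True
    \<comment> \<open>If \<open>e\<close> were red, \<open>e - {u}\<close> would play the role of
      \<open>T\<close>.\<close>
    then have "e - {u} \<in> [red_nbhd R V S]\<^bsup>(k-1)\<^esup>" "insert u (e - {u}) = e"
      using e Iprops(3) by (auto simp: nsets_def)
    then show ?thesis using contains_copy_half_graph[OF S u] no by metis
  next
    case False
    then have "e \<in> [I]\<^bsup>k\<^esup>" using e by (auto simp: nsets_def)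
    then show ?thesis using blue by blast
  qed
  ultimately show ?thesis by blast
qed

lemma card_le_of_maximal_clique:
  assumes V: "finite V" and k: "k \<ge> 1" and I: "I \<subseteq> V" "[I]\<^bsup>k\<^esup> \<inter> R = {}"
    and max: "\<And>v. v \<in> V - I \<Longrightarrow> [insert v I]\<^bsup>k\<^esup> \<inter> R \<noteq> {}"
    and deg: "\<And>S. S \<in> [V]\<^bsup>(k-1)\<^esup> \<Longrightarrow> card (red_nbhd R V S) \<le> d"
  shows "card V \<le> card I + (card I choose (k - 1)) * d"
proof -
  have fin: "finite I" using V I finite_subset by blast
  have "V \<subseteq> I \<union> (\<Union>S\<in>[I]\<^bsup>(k-1)\<^esup>. red_nbhd R V S)"
  proof
    fix v assume v: "v \<in> V"
    show "v \<in> I \<union> (\<Union>S\<in>[I]\<^bsup>(k-1)\<^esup>. red_nbhd R V S)"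
    proof (cases "v \<in> I")
      case False
      then obtain e where e: "e \<in> [insert v I]\<^bsup>k\<^esup>" "e \<in> R" using max v by blast
      \<comment> \<open>The red edge must use \<open>v\<close>, as \<open>I\<close> spans none; its
        other \<open>k - 1\<close> vertices form the set \<open>S\<close> with \<open>v\<close> in
        its red neighbourhood.\<close>
      have ve: "v \<in> e"
      proof (rule ccontr)
        assume "v \<notin> e"
        then have "e \<in> [I]\<^bsup>k\<^esup>" using e(1) by (auto simp: nsets_def)
        then show False using I e by blast
      qed
      then have "e - {v} \<in> [I]\<^bsup>(k-1)\<^esup>" using e(1) by (auto simp: nsets_def)
      moreover have "v \<in> red_nbhd R V (e - {v})"
        using v ve e(2) by (simp add: red_nbhd_def insert_absorb)
      ultimately show ?thesis by blast
    qed simp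
  qed
  moreover have "finite (red_nbhd R V S)" for S
    using V red_nbhd_subset finite_subset by metis
  ultimately have "card V \<le> card (I \<union> (\<Union>S\<in>[I]\<^bsup>(k-1)\<^esup>. red_nbhd R V S))"
    using fin by (intro card_mono finite_UnI finite_UN_I finite_imp_finite_nsets)
  also have "\<dots> \<le> card I + card (\<Union>S\<in>[I]\<^bsup>(k-1)\<^esup>. red_nbhd R V S)" by (rule card_Un_le)
  also have "card (\<Union>S\<in>[I]\<^bsup>(k-1)\<^esup>. red_nbhd R V S) \<le> (\<Sum>S\<in>[I]\<^bsup>(k-1)\<^esup>. card (red_nbhd R V S))"
    using fin finite_imp_finite_nsets by (intro card_UN_le) auto
  also have "\<dots> \<le> (\<Sum>S\<in>[I]\<^bsup>(k-1)\<^esup>. d)"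
    using deg nsets_mono[OF I(1)] by (intro sum_mono) blast
  also have "\<dots> = (card I choose (k - 1)) * d" using fin by (simp add: card_nsets)
  finally show ?thesis by simp
qed

lemma exists_maximal_clique:
  assumes "finite V" "k \<ge> 1"
  obtains I where "I \<subseteq> V" "[I]\<^bsup>k\<^esup> \<inter> R = {}" "\<And>v. v \<in> V - I \<Longrightarrow> [insert v I]\<^bsup>k\<^esup> \<inter> R \<noteq> {}"
proof -
  let ?C = "{I. I \<subseteq> V \<and> [I]\<^bsup>k\<^esup> \<inter> R = {}}"
  have "finite ?C" using assms by (auto intro: finite_subset[of _ "Pow V"])
  \<comment> \<open>For \<open>k = 0\<close> the empty set would itself be an edge, possibly
    red.\<close>
  moreover have "{} \<in> ?C" using assms(2) by (auto simp: nsets_def)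
  ultimately obtain I where "I \<in> ?C" "\<forall>J\<in>?C. I \<subseteq> J \<longrightarrow> I = J"
    using finite_has_maximal[of ?C] by blast
  then show ?thesis by (intro that[of I]) (blast+)
qed

text \<open>Lets half-graph-freeness pass from \<open>V\<close> to a red neighbourhood, where the
  induction hypothesis is applied.\<close>

lemma contains_copy_mono:
  assumes "contains_copy (V, E) H" "V \<subseteq> W"
  shows "contains_copy (W, E) H"
  using assms unfolding contains_copy_def by fastforce

text \<open>\<open>V\<close> is arbitrary so that the induction can move to a red neighbourhood with
  the same \<open>R\<close>. It starts at \<open>n = 0\<close> with the empty clique.\<close>

lemma half_graph_free_has_clique:
  assumes "k \<ge> 2" "finite V" "\<not> contains_copy (V, R) (half_graph k)"
    and "card V \<ge> fact n ^ (k - 1)"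
  shows "\<exists>I \<in> [V]\<^bsup>n\<^esup>. [I]\<^bsup>k\<^esup> \<inter> R = {}"
  using assms
proof (induction n arbitrary: V)
  case 0
  then show ?case by (auto simp: nsets_def)
next
  case (Suc n)
  define r :: nat where "r = fact n ^ (k - 1)"
  have r: "r \<ge> 1" by (simp add: r_def)
  show ?case
  proof (cases "\<exists>S \<in> [V]\<^bsup>(k-1)\<^esup>. card (red_nbhd R V S) \<ge> r")
    case True
    then obtain S where S: "S \<in> [V]\<^bsup>(k-1)\<^esup>" "card (red_nbhd R V S) \<ge> r" by blast
    have "finite (red_nbhd R V S)" using Suc.prems(2) red_nbhd_subset finite_subset by metis
    moreover have "\<not> contains_copy (red_nbhd R V S, R) (half_graph k)"
      using Suc.prems(3) contains_copy_mono red_nbhd_subset by metis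
    ultimately have "\<exists>I \<in> [red_nbhd R V S]\<^bsup>n\<^esup>. [I]\<^bsup>k\<^esup> \<inter> R = {}"
      using Suc.IH Suc.prems(1) S(2) r_def by simp
    then show ?thesis using large_red_nbhd_extends_clique Suc.prems(1,3) S(1) by metis
  next
    case False
    obtain I where I: "I \<subseteq> V" "[I]\<^bsup>k\<^esup> \<inter> R = {}"
      and max: "\<And>v. v \<in> V - I \<Longrightarrow> [insert v I]\<^bsup>k\<^esup> \<inter> R \<noteq> {}"
      using exists_maximal_clique[of V k R] Suc.prems by auto
    \<comment> \<open>The gain of one over \<open>r\<close> is what later absorbs the vertices of
      \<open>I\<close> itself.\<close>
    have "card (red_nbhd R V S) \<le> r - 1" if "S \<in> [V]\<^bsup>(k-1)\<^esup>" for S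
      using False that by fastforce
    then have le: "card V \<le> card I + (card I choose (k - 1)) * (r - 1)"
      using card_le_of_maximal_clique[OF Suc.prems(2) _ I max] Suc.prems(1) by auto
    have "card I \<ge> Suc n"
    proof (rule ccontr)
      assume "\<not> card I \<ge> Suc n"
      then have m: "card I < Suc n" by simp
      \<comment> \<open>With \<open>M = Suc n ^ (k - 1)\<close>, both \<open>card I < M\<close> and
        \<open>card I choose (k - 1) \<le> M\<close> hold, so
        \<open>card V < M + M * (r - 1) = M * r\<close>, which is the assumed lower bound on
        \<open>card V\<close>.\<close>
      have "Suc n ^ 1 \<le> Suc n ^ (k - 1)" using Suc.prems(1) by (intro power_increasing) auto
      then have "card I < Suc n ^ (k - 1)" using m by simp
      moreover have "card I choose (k - 1) \<le> Suc n ^ (k - 1)"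
      proof (cases "k - 1 \<le> card I")
        case True
        then show ?thesis
          using binomial_le_pow[of "k - 1" "card I"] m
            power_mono[of "card I" "Suc n" "k - 1"] by linarith
      qed (simp add: binomial_eq_0)
      then have "(card I choose (k - 1)) * (r - 1) \<le> Suc n ^ (k - 1) * (r - 1)"
        by (rule mult_le_mono1)
      ultimately have "card V < Suc n ^ (k - 1) + Suc n ^ (k - 1) * (r - 1)"
        using le by linarith
      also have "\<dots> = Suc n ^ (k - 1) * r"
        using r by (cases r) auto
      also have "\<dots> = fact (Suc n) ^ (k - 1)"
        by (simp only: r_def fact_Suc power_mult_distrib of_nat_id)
      finally show False using Suc.prems(4) by simp
    qed
    then obtain J where J: "J \<subseteq> I" "card J = Suc n" "finite J"
      by (meson obtain_subset_with_card_n)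
    then have "J \<in> [V]\<^bsup>Suc n\<^esup>" using I(1) by (auto simp: nsets_def)
    moreover have "[J]\<^bsup>k\<^esup> \<inter> R = {}" using nsets_mono[OF J(1), of k] I(2) by blast
    ultimately show ?thesis by blast
  qed
qed

theorem theorem5:
  fixes k n :: nat
  assumes "k \<ge> 4" and "n \<ge> k"
  shows "ramsey_number k (half_graph k) (complete_hypergraph k n) \<le> (fact n) ^ (k - 1)"
proof -
  define N :: nat where "N = fact n ^ (k - 1)"
  \<comment> \<open>A blue clique on \<open>n\<close> vertices is a blue copy of the complete
    hypergraph, so \<open>N\<close> has the arrow property and bounds the least such number.\<close>
  have "contains_copy ({..<N}, [{..<N}]\<^bsup>k\<^esup> - R) (complete_hypergraph k n)"
    if no: "\<not> contains_copy ({..<N}, R) (half_graph k)" for R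
  proof -
    obtain I where I: "I \<in> [{..<N}]\<^bsup>n\<^esup>" "[I]\<^bsup>k\<^esup> \<inter> R = {}"
      using half_graph_free_has_clique[OF _ _ no, of n] assms by (auto simp: N_def)
    have "[I]\<^bsup>k\<^esup> \<subseteq> [{..<N}]\<^bsup>k\<^esup>" using I(1) by (intro nsets_mono) (simp add: nsets_def)
    then have "[I]\<^bsup>k\<^esup> \<subseteq> [{..<N}]\<^bsup>k\<^esup> - R" using I(2) by blast
    then show ?thesis
      using I(1) by (intro contains_copy_clique[OF uniform_complete_hypergraph])
        (simp_all add: complete_hypergraph_def)
  qed
  then have "ramsey_arrow k N (half_graph k) (complete_hypergraph k n)"
    unfolding ramsey_arrow_def by blast
  then show ?thesis unfolding ramsey_number_def N_def by (rule Least_le)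
qed

end
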